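(* $(\mathcal{C}^N,\odot)$ is an Abelian group with identity element $\mathbf{1}_N\mathbf{1}_N^T$ (the $N\times N$ all-ones matrix), where $\odot$ is the Hadamard (entrywise) product.
   Context: The set $\mathcal{C}_L^N$ of L-CoLT (lower-collinear triangular) matrices consists of all $M=[m_{i,j}]\in\mathbb{R}^{N\times N}$ with $m_{i,j}=0$ for $i<j$ and $m_{i+1,j}/m_{i,j}=r_i$ for $j\le i$ (with $i\le N-1$), for some vector $\boldsymbol{r}\in(\mathbb{R}\setminus\{0\})^{N-1}$. The set $\mathcal{C}_U^N$ of U-CoLT (upper-collinear triangular) matrices consists of all $M=[m_{i,j}]\in\mathbb{R}^{N\times N}$ with $m_{i,j}=0$ for $i\ge j$ and $m_{i-1,j}/m_{i,j}=r'_{i-1}$ for $i<j$ (with $i\ge2$), for some vector $\boldsymbol{r}'\in(\mathbb{R}\setminus\{0\})^{N-2}$. $\mathcal{C}^N=\mathcal{C}_L^N+\mathcal{C}_U^N=\{A+B : A\in\mathcal{C}_L^N,\ B\in\mathcal{C}_U^N\}$.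
   Formalization: The formal definitions also require all entries of the triangular part (with diagonal for L-CoLT, without for U-CoLT) to be nonzero; the ratio conditions leave m_{N,N} and m_{1,2} free, and if these could vanish the matrix would have no Hadamard inverse. *)

theory Defs
  imports "Jordan_Normal_Form.Matrix"
begin

text \<open>
  Rows, columns and vector entries are indexed from 0, so the row index i here is the row index
  i + 1 of the usual notation.

  The nonvanishing of the triangular part is stated explicitly. The ratio conditions only force it
  for the entries they mention as a numerator or denominator; they do not mention the last diagonal
  entry of a lower matrix, nor the entry in the first row and second column of an upper one.
  If these were allowed to vanish, the sum set would contain matrices without a Hadamard inverse.
\<close>

definition lower_colt :: "nat \<Rightarrow> real mat set" where
  "lower_colt N = {M \<in> carrier_mat N N.
     (\<forall>i<N. \<forall>j<N. i < j \<longrightarrow> M $$ (i, j) = 0) \<and>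
     (\<forall>i<N. \<forall>j<N. j \<le> i \<longrightarrow> M $$ (i, j) \<noteq> 0) \<and>
     (\<exists>r \<in> carrier_vec (N - 1). (\<forall>i < N - 1. r $ i \<noteq> 0) \<and>
        (\<forall>i < N - 1. \<forall>j \<le> i. M $$ (i + 1, j) / M $$ (i, j) = r $ i))}"

definition upper_colt :: "nat \<Rightarrow> real mat set" where
  "upper_colt N = {M \<in> carrier_mat N N.
     (\<forall>i<N. \<forall>j<N. j \<le> i \<longrightarrow> M $$ (i, j) = 0) \<and>
     (\<forall>i<N. \<forall>j<N. i < j \<longrightarrow> M $$ (i, j) \<noteq> 0) \<and>
     (\<exists>r \<in> carrier_vec (N - 2). (\<forall>i < N - 2. r $ i \<noteq> 0) \<and>
        (\<forall>i \<ge> 1. \<forall>j<N. i < j \<longrightarrow> M $$ (i - 1, j) / M $$ (i, j) = r $ (i - 1)))}"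

definition colt :: "nat \<Rightarrow> real mat set" where
  "colt N = {A + B | A B. A \<in> lower_colt N \<and> B \<in> upper_colt N}"

definition hadamard :: "real mat \<Rightarrow> real mat \<Rightarrow> real mat" where
  "hadamard A B = mat (dim_row A) (dim_col A) (\<lambda>(i, j). A $$ (i, j) * B $$ (i, j))"

definition ones_mat :: "nat \<Rightarrow> real mat" where
  "ones_mat N = mat N N (\<lambda>(i, j). 1)"

definition colt_group :: "nat \<Rightarrow> real mat monoid" where
  "colt_group N = \<lparr>carrier = colt N, mult = hadamard, one = ones_mat N\<rparr>"

end

theory Submission
  imports Defs "HOL-Algebra.Group"
begin

text \<open>
  A matrix is a sum of a lower and an upper CoLT matrix exactly when all its entries are nonzero
  and the quotients of vertically adjacent entries depend only on the row, separately on and below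
  the diagonal and above it. These conditions are stable under entrywise products and inverses, so
  the group axioms reduce to those of the multiplicative group of nonzero reals.
\<close>

lemma lower_colt_iff:
  "M \<in> lower_colt N \<longleftrightarrow> M \<in> carrier_mat N N
     \<and> (\<forall>i<N. \<forall>j<N. i < j \<longrightarrow> M $$ (i, j) = 0)
     \<and> (\<forall>i<N. \<forall>j<N. j \<le> i \<longrightarrow> M $$ (i, j) \<noteq> 0)
     \<and> (\<exists>r. \<forall>i j. Suc i < N \<longrightarrow> j \<le> i \<longrightarrow> M $$ (Suc i, j) / M $$ (i, j) = r i)"
  (is "_ \<longleftrightarrow> ?C \<and> ?Z \<and> ?NZ \<and> ?R")
proof
  assume M: "M \<in> lower_colt N"
  then obtain v
    where v [rule_format]: "\<forall>i < N - 1. \<forall>j \<le> i. M $$ (i + 1, j) / M $$ (i, j) = v $ i"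
    unfolding lower_colt_def by (elim CollectE conjE bexE) (rule that)
  have "M $$ (Suc i, j) / M $$ (i, j) = v $ i" if "Suc i < N" "j \<le> i" for i j
    using v[of i j] that by simp
  then have ?R by blast
  from M show "?C \<and> ?Z \<and> ?NZ \<and> ?R"
    unfolding lower_colt_def by (elim CollectE conjE) (intro conjI \<open>?R\<close>)
next
  assume *: "?C \<and> ?Z \<and> ?NZ \<and> ?R"
  then obtain r where r [rule_format]:
    "\<forall>i j. Suc i < N \<longrightarrow> j \<le> i \<longrightarrow> M $$ (Suc i, j) / M $$ (i, j) = r i"
    by (elim conjE exE) (rule that)
  from * have nz: "M $$ (i, j) \<noteq> 0" if "i < N" "j \<le> i" for i j
    using that by simp
  have "r i \<noteq> 0" if "Suc i < N" for i
    using r[of i 0] nz[of i 0] nz[of "Suc i" 0] that by auto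
  then have "\<exists>v \<in> carrier_vec (N - 1). (\<forall>i < N - 1. v $ i \<noteq> 0) \<and>
      (\<forall>i < N - 1. \<forall>j \<le> i. M $$ (i + 1, j) / M $$ (i, j) = v $ i)"
    using r by (intro bexI[of _ "vec (N - 1) r"]) auto
  then show "M \<in> lower_colt N"
    using * unfolding lower_colt_def by (elim conjE) (intro CollectI conjI)
qed

lemma upper_colt_iff:
  "M \<in> upper_colt N \<longleftrightarrow> M \<in> carrier_mat N N
     \<and> (\<forall>i<N. \<forall>j<N. j \<le> i \<longrightarrow> M $$ (i, j) = 0)
     \<and> (\<forall>i<N. \<forall>j<N. i < j \<longrightarrow> M $$ (i, j) \<noteq> 0)
     \<and> (\<exists>s. \<forall>i j. Suc i < j \<longrightarrow> j < N \<longrightarrow> M $$ (i, j) / M $$ (Suc i, j) = s i)"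
  (is "_ \<longleftrightarrow> ?C \<and> ?Z \<and> ?NZ \<and> ?R")
proof
  assume M: "M \<in> upper_colt N"
  then obtain v where v [rule_format]:
    "\<forall>i \<ge> 1. \<forall>j<N. i < j \<longrightarrow> M $$ (i - 1, j) / M $$ (i, j) = v $ (i - 1)"
    unfolding upper_colt_def by (elim CollectE conjE bexE) (rule that)
  have "M $$ (i, j) / M $$ (Suc i, j) = v $ i" if "Suc i < j" "j < N" for i j
    using v[of "Suc i" j] that by simp
  then have ?R by blast
  from M show "?C \<and> ?Z \<and> ?NZ \<and> ?R"
    unfolding upper_colt_def by (elim CollectE conjE) (intro conjI \<open>?R\<close>)
next
  assume *: "?C \<and> ?Z \<and> ?NZ \<and> ?R"
  then obtain s where s [rule_format]:
    "\<forall>i j. Suc i < j \<longrightarrow> j < N \<longrightarrow> M $$ (i, j) / M $$ (Suc i, j) = s i"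
    by (elim conjE exE) (rule that)
  have "s i \<noteq> 0" if "i < N - 2" for i
  proof -
    have "Suc i < i + 2" "i + 2 < N" using that by auto
    then show ?thesis using * by (auto simp flip: s[of i "i + 2"])
  qed
  moreover have "M $$ (i - 1, j) / M $$ (i, j) = vec (N - 2) s $ (i - 1)"
    if "i \<ge> 1" "j < N" "i < j" for i j
    using s[of "i - 1" j] that by auto
  ultimately have "\<exists>v \<in> carrier_vec (N - 2). (\<forall>i < N - 2. v $ i \<noteq> 0) \<and>
      (\<forall>i \<ge> 1. \<forall>j<N. i < j \<longrightarrow> M $$ (i - 1, j) / M $$ (i, j) = v $ (i - 1))"
    by (intro bexI[of _ "vec (N - 2) s"]) auto
  then show "M \<in> upper_colt N"
    using * unfolding upper_colt_def by (elim conjE) (intro CollectI conjI)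
qed

lemma colt_iff:
  "M \<in> colt N \<longleftrightarrow> M \<in> carrier_mat N N
     \<and> (\<forall>i<N. \<forall>j<N. M $$ (i, j) \<noteq> 0)
     \<and> (\<exists>r. \<forall>i j. Suc i < N \<longrightarrow> j \<le> i \<longrightarrow> M $$ (Suc i, j) / M $$ (i, j) = r i)
     \<and> (\<exists>s. \<forall>i j. Suc i < j \<longrightarrow> j < N \<longrightarrow> M $$ (i, j) / M $$ (Suc i, j) = s i)"
  (is "_ \<longleftrightarrow> ?C \<and> ?NZ \<and> ?R \<and> ?S")
proof
  assume "M \<in> colt N"
  then obtain A B where M: "M = A + B" and A: "A \<in> lower_colt N" and B: "B \<in> upper_colt N"
    unfolding colt_def by blast
  note A' = A[unfolded lower_colt_iff] and B' = B[unfolded upper_colt_iff]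
  have low: "M $$ (i, j) = A $$ (i, j)" if "i < N" "j \<le> i" for i j
    using A' B' that by (auto simp: M)
  have up: "M $$ (i, j) = B $$ (i, j)" if "j < N" "i < j" for i j
    using A' B' that by (auto simp: M)
  have ?C using A' B' by (auto simp: M)
  moreover have ?NZ
    using A' B' low up by (metis not_le)
  moreover obtain r where "\<forall>i j. Suc i < N \<longrightarrow> j \<le> i \<longrightarrow> A $$ (Suc i, j) / A $$ (i, j) = r i"
    using A' by (elim conjE exE) (rule that)
  then have ?R by (intro exI[of _ r]) (simp add: low)
  moreover obtain s where "\<forall>i j. Suc i < j \<longrightarrow> j < N \<longrightarrow> B $$ (i, j) / B $$ (Suc i, j) = s i"
    using B' by (elim conjE exE) (rule that)
  then have ?S by (intro exI[of _ s]) (simp add: up)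
  ultimately show "?C \<and> ?NZ \<and> ?R \<and> ?S" by blast
next
  assume *: "?C \<and> ?NZ \<and> ?R \<and> ?S"
  define A where "A = mat N N (\<lambda>(i, j). if j \<le> i then M $$ (i, j) else 0)"
  define B where "B = mat N N (\<lambda>(i, j). if i < j then M $$ (i, j) else 0)"
  have "A \<in> lower_colt N"
    using * unfolding lower_colt_iff by (auto simp: A_def)
  moreover have "B \<in> upper_colt N"
    using * unfolding upper_colt_iff by (auto simp: B_def)
  moreover have "M = A + B"
    using * by (auto simp: A_def B_def)
  ultimately show "M \<in> colt N"
    unfolding colt_def by blast
qed

lemma hadamard_closed:
  assumes "A \<in> colt N" "B \<in> colt N"
  shows "hadamard A B \<in> colt N"
proof -
  note A = assms(1)[unfolded colt_iff] and B = assms(2)[unfolded colt_iff]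
  obtain r s where r [rule_format]: "\<forall>i j. Suc i < N \<longrightarrow> j \<le> i \<longrightarrow> A $$ (Suc i, j) / A $$ (i, j) = r i"
    and s [rule_format]: "\<forall>i j. Suc i < j \<longrightarrow> j < N \<longrightarrow> A $$ (i, j) / A $$ (Suc i, j) = s i"
    using A by (elim conjE exE) (rule that)
  obtain r' s' where r' [rule_format]: "\<forall>i j. Suc i < N \<longrightarrow> j \<le> i \<longrightarrow> B $$ (Suc i, j) / B $$ (i, j) = r' i"
    and s' [rule_format]: "\<forall>i j. Suc i < j \<longrightarrow> j < N \<longrightarrow> B $$ (i, j) / B $$ (Suc i, j) = s' i"
    using B by (elim conjE exE) (rule that)
  show ?thesis
    unfolding colt_iff
  proof (intro conjI exI allI impI)
    show "hadamard A B $$ (Suc i, j) / hadamard A B $$ (i, j) = r i * r' i"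
      if "Suc i < N" "j \<le> i" for i j
      using A that by (auto simp: hadamard_def simp flip: r[OF that] r'[OF that])
    show "hadamard A B $$ (i, j) / hadamard A B $$ (Suc i, j) = s i * s' i"
      if "Suc i < j" "j < N" for i j
      using A that by (auto simp: hadamard_def simp flip: s[OF that] s'[OF that])
  qed (use A B in \<open>auto simp: hadamard_def\<close>)
qed

lemma hadamard_inverse_closed:
  assumes "A \<in> colt N"
  shows "map_mat inverse A \<in> colt N"
proof -
  note A = assms[unfolded colt_iff]
  obtain r s where r [rule_format]: "\<forall>i j. Suc i < N \<longrightarrow> j \<le> i \<longrightarrow> A $$ (Suc i, j) / A $$ (i, j) = r i"
    and s [rule_format]: "\<forall>i j. Suc i < j \<longrightarrow> j < N \<longrightarrow> A $$ (i, j) / A $$ (Suc i, j) = s i"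
    using A by (elim conjE exE) (rule that)
  show ?thesis
    unfolding colt_iff
  proof (intro conjI exI allI impI)
    show "map_mat inverse A $$ (Suc i, j) / map_mat inverse A $$ (i, j) = inverse (r i)"
      if "Suc i < N" "j \<le> i" for i j
      using A that by (auto simp: field_simps simp flip: r[OF that])
    show "map_mat inverse A $$ (i, j) / map_mat inverse A $$ (Suc i, j) = inverse (s i)"
      if "Suc i < j" "j < N" for i j
      using A that by (auto simp: field_simps simp flip: s[OF that])
  qed (use A in auto)
qed

lemma ones_mat_closed: "ones_mat N \<in> colt N"
  unfolding colt_iff by (auto simp: ones_mat_def)

lemma hadamard_assoc:
  assumes "A \<in> carrier_mat m n" "B \<in> carrier_mat m n"
  shows "hadamard (hadamard A B) C = hadamard A (hadamard B C)"
  using assms by (auto simp: hadamard_def)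

lemma hadamard_comm:
  assumes "A \<in> carrier_mat m n" "B \<in> carrier_mat m n"
  shows "hadamard A B = hadamard B A"
  using assms by (auto simp: hadamard_def)

lemma hadamard_ones_left:
  assumes "A \<in> carrier_mat N N"
  shows "hadamard (ones_mat N) A = A"
  using assms by (auto simp: hadamard_def ones_mat_def)

lemma hadamard_inverse_left:
  assumes "A \<in> colt N"
  shows "hadamard (map_mat inverse A) A = ones_mat N"
  using assms by (auto simp: colt_iff hadamard_def ones_mat_def)

theorem corollary3p5:
  fixes N :: nat
  assumes "N \<ge> 1"
  shows "comm_group (colt_group N)"
proof -
  have carrier: "A \<in> carrier_mat N N" if "A \<in> colt N" for A
    using that by (simp add: colt_iff)
  show ?thesis
  proof (rule comm_groupI)
    show "\<exists>B \<in> carrier (colt_group N). B \<otimes>\<^bsub>colt_group N\<^esub> A = \<one>\<^bsub>colt_group N\<^esub>"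
      if "A \<in> carrier (colt_group N)" for A
      using that
      by (auto simp: colt_group_def
          intro!: bexI[of _ "map_mat inverse A"] hadamard_inverse_closed hadamard_inverse_left)
    show "A \<otimes>\<^bsub>colt_group N\<^esub> B = B \<otimes>\<^bsub>colt_group N\<^esub> A"
      if "A \<in> carrier (colt_group N)" "B \<in> carrier (colt_group N)" for A B
      using that hadamard_comm[OF carrier carrier] by (simp add: colt_group_def)
  qed (simp_all add: colt_group_def hadamard_closed ones_mat_closed
      hadamard_ones_left[OF carrier] hadamard_assoc[OF carrier carrier])
qed

end
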